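(* Let $\lambda>0$, $\varepsilon>0$ and $\sigma=\sigma(\lambda,\varepsilon)$. (i) Under $\widehat P_{\lambda,t}$, the number of particles $n(t)$ at time $t$ is geometrically distributed with parameter $1-\sigma(1-e^{-t})$. In particular, as $t\uparrow\infty$, the law of $n(t)$ under $\widehat P_{\lambda,t}$ converges to the geometric distribution with parameter $1-\sigma$. (ii) For every $\rho\le -\ln(1-\sigma)$, as $t\uparrow\infty$, the number of particles $n(s(t))$ at time $s(t)=t+\ln(1-\sigma)+\rho$ under $\widehat P_{\lambda,t}$ converges in distribution to a geometric random variable with parameter $(1+\sigma e^{\rho})^{-1}$.
   Context: Binary branching Brownian motion (BBM) on $\mathbb{R}$: start with a single particle at $0$ at time $0$. Each particle moves as a standard Brownian motion and lives for an independent standard (rate $1$) exponential time, at the end of which it is replaced by exactly two particles that continue from its position independently according to the same rules. $\mathbb{P}$, $\mathbb{E}$ denote the law and expectation of BBM and $n(t)$ is the number of particles at time $t$. Set $\sigma(\lambda,\varepsilon)=\operatorname{sech}(\varepsilon\sqrt{2\lambda})$, and $v_\sigma(t)=\mathbb{E}[\sigma^{n(t)-1}]$. The simplified model with self-repulsion is the tilted law $\widehat P_{\lambda,t}(A)=\mathbb{E}[\mathbf 1_A\,\sigma(\lambda,\varepsilon)^{n(t)-1}]/v_{\sigma(\lambda,\varepsilon)}(t)$. A geometric random variable with parameter $p\in(0,1]$ takes the value $k$ with probability $p(1-p)^{k-1}$, $k=1,2,3,\dots$. *)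

theory Defs
  imports "HOL-Probability.Probability"
begin

text \<open>Standard one-dimensional Brownian motion on the time set \<open>{0..}\<close>; the values at
  negative times are irrelevant.\<close>

locale brownian_motion = prob_space M for M :: "'a measure" +
  fixes W :: "real \<Rightarrow> 'a \<Rightarrow> real"
  assumes measurable_W: "\<And>t. 0 \<le> t \<Longrightarrow> W t \<in> borel_measurable M"
    and start_zero: "AE \<omega> in M. W 0 \<omega> = 0"
    and indep_increments: "\<And>(s :: nat \<Rightarrow> real) n. 0 \<le> s 0 \<Longrightarrow> incseq s \<Longrightarrow>
      indep_vars (\<lambda>_. borel) (\<lambda>i \<omega>. W (s (Suc i)) \<omega> - W (s i) \<omega>) {..<n}"
    and normal_increments: "\<And>s t. 0 \<le> s \<Longrightarrow> s < t \<Longrightarrow>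
      distributed M lborel (\<lambda>\<omega>. W t \<omega> - W s \<omega>) (normal_density 0 (sqrt (t - s)))"
    and continuous_paths: "AE \<omega> in M. continuous_on {0..} (\<lambda>t. W t \<omega>)"

text \<open>Particles are labelled by Ulam--Harris words over \<open>bool\<close>: \<open>[]\<close> is the initial particle
  and the two children of \<open>u\<close> are \<open>False # u\<close> and \<open>True # u\<close>. The particle \<open>u\<close> has lifetime
  \<open>T u\<close>, and \<open>B u s\<close> is its displacement from its place of birth at age \<open>s\<close>.\<close>

locale branching_brownian_motion = prob_space M for M :: "'a measure" +
  fixes T :: "bool list \<Rightarrow> 'a \<Rightarrow> real"
    and B :: "bool list \<Rightarrow> real \<Rightarrow> 'a \<Rightarrow> real"
  assumes lifetimes: "\<And>u. distributed M lborel (T u) (exponential_density 1)"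
    and motions: "\<And>u. brownian_motion M (B u)"
    \<comment> \<open>all lifetimes and all displacement processes are jointly independent\<close>
    and independence:
      "indep_sets (case_sum
         (\<lambda>u. {T u -` A \<inter> space M | A. A \<in> sets borel})
         (\<lambda>u. {(\<lambda>\<omega>. \<lambda>s\<in>{0..}. B u s \<omega>) -` A \<inter> space M | A.
                A \<in> sets (Pi\<^sub>M {0..} (\<lambda>_. borel))})) UNIV"

primrec birth_time :: "(bool list \<Rightarrow> 'a \<Rightarrow> real) \<Rightarrow> bool list \<Rightarrow> 'a \<Rightarrow> real" where
  "birth_time T [] \<omega> = 0"
| "birth_time T (c # u) \<omega> = birth_time T u \<omega> + T u \<omega>"

primrec birth_place ::
  "(bool list \<Rightarrow> 'a \<Rightarrow> real) \<Rightarrow> (bool list \<Rightarrow> real \<Rightarrow> 'a \<Rightarrow> real) \<Rightarrow> bool list \<Rightarrow> 'a \<Rightarrow> real" where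
  "birth_place T B [] \<omega> = 0"
| "birth_place T B (c # u) \<omega> = birth_place T B u \<omega> + B u (T u \<omega>) \<omega>"

definition alive :: "(bool list \<Rightarrow> 'a \<Rightarrow> real) \<Rightarrow> real \<Rightarrow> 'a \<Rightarrow> bool list set" where
  "alive T t \<omega> = {u. birth_time T u \<omega> \<le> t \<and> t < birth_time T u \<omega> + T u \<omega>}"

definition position ::
  "(bool list \<Rightarrow> 'a \<Rightarrow> real) \<Rightarrow> (bool list \<Rightarrow> real \<Rightarrow> 'a \<Rightarrow> real) \<Rightarrow> real \<Rightarrow> bool list \<Rightarrow> 'a \<Rightarrow> real" where
  "position T B t u \<omega> = birth_place T B u \<omega> + B u (t - birth_time T u \<omega>) \<omega>"

text \<open>The state of the branching Brownian motion at time \<open>t\<close>: the particles together with their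
  positions.\<close>

definition particles ::
  "(bool list \<Rightarrow> 'a \<Rightarrow> real) \<Rightarrow> (bool list \<Rightarrow> real \<Rightarrow> 'a \<Rightarrow> real) \<Rightarrow> real \<Rightarrow> 'a \<Rightarrow> (bool list \<times> real) set" where
  "particles T B t \<omega> = (\<lambda>u. (u, position T B t u \<omega>)) ` alive T t \<omega>"

text \<open>At a fixed time the set of particles is almost surely finite and nonempty; the value
  \<open>card A = 0\<close> for infinite \<open>A\<close> thus only matters on a null set.\<close>

definition num_particles ::
  "(bool list \<Rightarrow> 'a \<Rightarrow> real) \<Rightarrow> (bool list \<Rightarrow> real \<Rightarrow> 'a \<Rightarrow> real) \<Rightarrow> real \<Rightarrow> 'a \<Rightarrow> nat" where
  "num_particles T B t \<omega> = card (particles T B t \<omega>)"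

definition sech :: "real \<Rightarrow> real" where
  "sech x = 1 / cosh x"

definition repulsion :: "real \<Rightarrow> real \<Rightarrow> real" where
  "repulsion lam eps = sech (eps * sqrt (2 * lam))"

definition v_sigma ::
  "'a measure \<Rightarrow> (bool list \<Rightarrow> 'a \<Rightarrow> real) \<Rightarrow> (bool list \<Rightarrow> real \<Rightarrow> 'a \<Rightarrow> real) \<Rightarrow> real \<Rightarrow> real \<Rightarrow> real" where
  "v_sigma M T B \<sigma> t = prob_space.expectation M (\<lambda>\<omega>. \<sigma> ^ (num_particles T B t \<omega> - 1))"

definition tilted_law ::
  "'a measure \<Rightarrow> (bool list \<Rightarrow> 'a \<Rightarrow> real) \<Rightarrow> (bool list \<Rightarrow> real \<Rightarrow> 'a \<Rightarrow> real)
    \<Rightarrow> real \<Rightarrow> real \<Rightarrow> real \<Rightarrow> 'a measure" where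
  "tilted_law M T B lam eps t =
     density M (\<lambda>\<omega>. repulsion lam eps ^ (num_particles T B t \<omega> - 1)
                      / v_sigma M T B (repulsion lam eps) t)"

text \<open>The geometric distribution on \<open>{1, 2, 3, \<dots>}\<close>; the library's \<^const>\<open>geometric_pmf\<close> lives
  on \<open>{0, 1, 2, \<dots>}\<close>.\<close>

definition geometric1_pmf :: "real \<Rightarrow> nat pmf" where
  "geometric1_pmf p = map_pmf Suc (geometric_pmf p)"

lemma pmf_geometric1:
  assumes "0 < p" "p \<le> 1"
  shows "pmf (geometric1_pmf p) k = (if k = 0 then 0 else p * (1 - p) ^ (k - 1))"
proof (cases k)
  case 0
  then show ?thesis
    by (auto simp: geometric1_pmf_def pmf_eq_0_set_pmf)
next
  case (Suc j)
  then show ?thesis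
    using assms by (simp add: geometric1_pmf_def pmf_map_inj')
qed

text \<open>Convergence in distribution as a real parameter tends to infinity: \<^const>\<open>weak_conv_m\<close> with
  the sequential limit replaced by \<open>at_top\<close>. Laws on \<open>nat\<close> are viewed as laws on the real line.\<close>

definition weak_conv_at_top :: "(real \<Rightarrow> real measure) \<Rightarrow> real measure \<Rightarrow> bool" where
  "weak_conv_at_top \<mu> \<nu> \<longleftrightarrow>
     (\<forall>x. isCont (cdf \<nu>) x \<longrightarrow> ((\<lambda>t. cdf (\<mu> t) x) \<longlongrightarrow> cdf \<nu> x) at_top)"

end

theory Submission
  imports Defs
begin

text \<open>
  The number of particles depends on the lifetimes only and is a Yule process. Write
  \<open>\<phi>\<^sub>t(z) = E[z\<^bsup>n(t)\<^esup>]\<close>. Splitting at the death of the initial particle, the two subtrees are independent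
  copies of the whole tree (\<open>distr_graft\<close>), whence
  \<open>\<phi>\<^sub>t = z e\<^bsup>-t\<^esup> + \<integral>\<^sub>0\<^sup>t e\<^bsup>-a\<^esup> \<phi>\<^bsub>t-a\<^esub>\<^sup>2 da\<close>, with the unique solution
  \<open>\<phi>\<^sub>t(z) = z e\<^bsup>-t\<^esup> / (1 - z (1 - e\<^bsup>-t\<^esup>))\<close> (\<open>yule_integral_equation\<close>).

  The same equation handles two times at once. With \<open>d \<ge> 0\<close> fixed, the functional
  \<open>z\<^bsup>n(s)\<^esup> q\<^bsup>n(s+d)\<^esup>\<close> is also multiplicative over the two subtrees once the initial particle has split
  before \<open>s\<close>, and given that it is still alive at \<open>s\<close> the conditional expectation is \<open>z \<phi>\<^sub>d(q)\<close> by lack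
  of memory of its lifetime. The initial value \<open>z\<close> is thus replaced by \<open>z \<phi>\<^sub>d(q)\<close>, and
  \<open>E[z\<^bsup>n(s)\<^esup> q\<^bsup>n(t)\<^esup>] = \<phi>\<^sub>s(z \<phi>\<^bsub>t-s\<^esub>(q))\<close> (\<open>nn_integral_weight_two_times\<close>).

  Taking \<open>q = \<sigma>\<close> and normalizing, the generating function of \<open>n(s)\<close> under the tilted law at
  horizon \<open>t\<close> is that of a geometric law with parameter \<open>1 - \<phi>\<^bsub>t-s\<^esub>(\<sigma>) (1 - e\<^bsup>-s\<^esup>)\<close>, exactly and for all
  \<open>0 \<le> s \<le> t\<close> (\<open>tilted_num_particles_geometric\<close>). For \<open>s = t\<close> the parameter is
  \<open>1 - \<sigma> (1 - e\<^bsup>-t\<^esup>)\<close>. For \<open>s = t + ln (1 - \<sigma>) + \<rho>\<close> the delay \<open>d = t - s\<close> satisfies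
  \<open>e\<^bsup>-d\<^esup> = (1 - \<sigma>) e\<^sup>\<rho>\<close>, so \<open>\<phi>\<^sub>d(\<sigma>) = \<sigma> e\<^sup>\<rho> / (1 + \<sigma> e\<^sup>\<rho>)\<close> and the parameter tends to
  \<open>1 / (1 + \<sigma> e\<^sup>\<rho>)\<close>.
\<close>

section \<open>The law of the lifetimes and its recursive structure\<close>

definition exp_law :: "real measure" where
  "exp_law = density lborel (exponential_density 1)"

definition clock_law :: "(bool list \<Rightarrow> real) measure" where
  "clock_law = Pi\<^sub>M UNIV (\<lambda>_. exp_law)"

definition subclocks :: "bool \<Rightarrow> (bool list \<Rightarrow> real) \<Rightarrow> bool list \<Rightarrow> real" where
  "subclocks c x = (\<lambda>u. x (u @ [c]))"

text \<open>The inverse of \<open>x \<mapsto> (x [], subclocks False x, subclocks True x)\<close>. A child is \<open>c # u\<close>, so the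
  first split below the initial particle is recorded in the last letter of a word.\<close>
definition graft :: "real \<times> (bool list \<Rightarrow> real) \<times> (bool list \<Rightarrow> real) \<Rightarrow> bool list \<Rightarrow> real" where
  "graft = (\<lambda>(a, l, r) u. if u = [] then a else if last u then r (butlast u) else l (butlast u))"

lemma sets_exp_law [measurable_cong, simp]: "sets exp_law = sets borel"
  by (simp add: exp_law_def)

lemma space_exp_law [simp]: "space exp_law = UNIV"
  by (simp add: exp_law_def)

lemma prob_space_exp_law: "prob_space exp_law"
  unfolding exp_law_def by (rule prob_space_exponential_density) simp

lemma sets_clock_law [measurable_cong]: "sets clock_law = sets (Pi\<^sub>M UNIV (\<lambda>_. borel))"
  unfolding clock_law_def by (rule sets_PiM_cong) simp_all

lemma space_clock_law [simp]: "space clock_law = UNIV"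
  by (simp add: clock_law_def space_PiM PiE_UNIV_domain)

lemma prob_space_clock_law: "prob_space clock_law"
  unfolding clock_law_def by (intro prob_space_PiM prob_space_exp_law)

interpretation exp_law: prob_space exp_law by (rule prob_space_exp_law)
interpretation clock_law: prob_space clock_law by (rule prob_space_clock_law)

lemma measurable_clock [measurable]: "(\<lambda>x. x u) \<in> borel_measurable clock_law"
  by (simp add: sets_clock_law cong: measurable_cong_sets)

lemma measurable_subclocks [measurable]: "subclocks c \<in> clock_law \<rightarrow>\<^sub>M clock_law"
proof -
  have "subclocks c \<in> clock_law \<rightarrow>\<^sub>M Pi\<^sub>M UNIV (\<lambda>_. borel)"
    unfolding subclocks_def by (rule measurable_PiM_single') (auto simp: space_PiM)
  then show ?thesis
    by (simp add: sets_clock_law cong: measurable_cong_sets)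
qed

lemma measurable_graft [measurable]:
  "graft \<in> exp_law \<Otimes>\<^sub>M (clock_law \<Otimes>\<^sub>M clock_law) \<rightarrow>\<^sub>M clock_law"
proof -
  have "graft \<in> exp_law \<Otimes>\<^sub>M (clock_law \<Otimes>\<^sub>M clock_law) \<rightarrow>\<^sub>M Pi\<^sub>M UNIV (\<lambda>_. borel)"
    unfolding graft_def split_beta'
    by (rule measurable_PiM_single') (auto simp: space_PiM)
  then show ?thesis
    by (simp add: sets_clock_law cong: measurable_cong_sets)
qed

lemma graft_simps [simp]:
  "graft (a, l, r) [] = a"
  "subclocks False (graft (a, l, r)) = l"
  "subclocks True (graft (a, l, r)) = r"
  by (simp_all add: graft_def subclocks_def)

lemma emeasure_clock_law_cylinder:
  assumes "finite J" "\<And>u. u \<in> J \<Longrightarrow> A u \<in> sets borel"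
  shows "emeasure clock_law {x. \<forall>u\<in>J. x u \<in> A u} = (\<Prod>u\<in>J. emeasure exp_law (A u))"
proof -
  interpret product_prob_space "\<lambda>_::bool list. exp_law" UNIV
    by (rule product_prob_spaceI) (rule prob_space_exp_law)
  show ?thesis
    using emeasure_PiM_Collect[of J A] assms
    by (simp add: clock_law_def space_PiM PiE_UNIV_domain)
qed

lemma sets_clock_law_cylinder:
  assumes "finite J" "\<And>u. u \<in> J \<Longrightarrow> A u \<in> sets borel"
  shows "{x. \<forall>u\<in>J. x u \<in> A u} \<in> sets clock_law"
proof -
  have "{x \<in> space clock_law. x u \<in> A u} \<in> sets clock_law" if "u \<in> J" for u
    using assms(2)[OF that] measurable_sets[OF measurable_clock] by (auto simp: vimage_def Int_def)
  then have "{x \<in> space clock_law. \<forall>u\<in>J. x u \<in> A u} \<in> sets clock_law"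
    using assms(1) by (intro sets.sets_Collect_finite_All) auto
  then show ?thesis by simp
qed

lemma snoc_cases_bool: "u = [] \<or> (\<exists>v. u = v @ [False]) \<or> (\<exists>v. u = v @ [True])"
proof (cases u rule: rev_cases)
  case (snoc v c)
  then show ?thesis by (cases c) auto
qed simp

text \<open>Grafting two independent trees of clocks below an independent exponential clock gives a tree with
  the original law: both measures agree on cylinders, because the words in a finite set \<open>J\<close> fall into the
  empty word and the words ending in \<open>False\<close> or in \<open>True\<close>. This is the branching property.\<close>
lemma distr_graft:
  "distr (exp_law \<Otimes>\<^sub>M (clock_law \<Otimes>\<^sub>M clock_law)) clock_law graft = clock_law"
proof (rule measure_eqI_PiM_infinite[where I=UNIV and M="\<lambda>_. exp_law"])
  interpret C2: pair_prob_space clock_law clock_law ..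
  interpret C3: pair_prob_space exp_law "clock_law \<Otimes>\<^sub>M clock_law" ..
  show "finite_measure (distr (exp_law \<Otimes>\<^sub>M (clock_law \<Otimes>\<^sub>M clock_law)) clock_law graft)"
    using C3.prob_space_distr[of graft clock_law] measurable_graft
    by (simp add: prob_space.finite_measure)
next
  fix A :: "bool list \<Rightarrow> real set" and J :: "bool list set"
  assume J: "finite J" and A': "\<And>i. i \<in> J \<Longrightarrow> A i \<in> sets exp_law"
  interpret C2: pair_prob_space clock_law clock_law ..
  define S where "S c = (\<lambda>v. v @ [c]) -` J" for c :: bool
  have finS: "finite (S c)" for c
    by (rule finite_subset[of _ "butlast ` J"]) (use J in \<open>auto simp: S_def intro: image_eqI[rotated]\<close>)
  define A0 where "A0 = (if [] \<in> J then A [] else UNIV)"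
  define C where "C c = {x. \<forall>v\<in>S c. x v \<in> A (v @ [c])}" for c
  have A: "\<And>u. u \<in> J \<Longrightarrow> A u \<in> sets borel" using A' by simp
  have [measurable]: "A0 \<in> sets borel" using A by (auto simp: A0_def)
  have C: "emeasure clock_law (C c) = (\<Prod>v\<in>S c. emeasure exp_law (A (v @ [c])))" for c
    unfolding C_def by (rule emeasure_clock_law_cylinder, rule finS, rule A) (simp add: S_def)
  have [measurable]: "C c \<in> sets clock_law" for c
    unfolding C_def by (rule sets_clock_law_cylinder, rule finS, rule A) (simp add: S_def)
  have cyl: "prod_emb UNIV (\<lambda>_. exp_law) J (Pi\<^sub>E J A) = {x. \<forall>u\<in>J. x u \<in> A u}"
    by (auto simp: prod_emb_def space_PiM PiE_UNIV_domain PiE_iff)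
  have cylm: "{x. \<forall>u\<in>J. x u \<in> A u} \<in> sets clock_law"
    using J A by (rule sets_clock_law_cylinder)
  have J_eq: "J = (J \<inter> {[]}) \<union> ((\<lambda>v. v @ [False]) ` S False \<union> (\<lambda>v. v @ [True]) ` S True)"
  proof (rule set_eqI)
    fix u show "u \<in> J \<longleftrightarrow> u \<in> (J \<inter> {[]}) \<union> ((\<lambda>v. v @ [False]) ` S False \<union> (\<lambda>v. v @ [True]) ` S True)"
      using snoc_cases_bool[of u] by (auto simp: S_def image_iff)
  qed
  have pre: "graft -` {x. \<forall>u\<in>J. x u \<in> A u} = A0 \<times> C False \<times> C True"
  proof (rule set_eqI)
    fix p :: "real \<times> (bool list \<Rightarrow> real) \<times> (bool list \<Rightarrow> real)"
    obtain a l r where p: "p = (a, l, r)" by (cases p)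
    have "(\<forall>u\<in>J. graft p u \<in> A u) \<longleftrightarrow> (\<forall>u\<in>J \<inter> {[]}. graft p u \<in> A u)
        \<and> (\<forall>v\<in>S False. graft p (v @ [False]) \<in> A (v @ [False]))
        \<and> (\<forall>v\<in>S True. graft p (v @ [True]) \<in> A (v @ [True]))"
      by (subst J_eq) (simp add: ball_Un)
    then show "p \<in> graft -` {x. \<forall>u\<in>J. x u \<in> A u} \<longleftrightarrow> p \<in> A0 \<times> C False \<times> C True"
      by (auto simp: p graft_def A0_def C_def)
  qed
  have "emeasure (distr (exp_law \<Otimes>\<^sub>M (clock_law \<Otimes>\<^sub>M clock_law)) clock_law graft) {x. \<forall>u\<in>J. x u \<in> A u}
      = emeasure (exp_law \<Otimes>\<^sub>M (clock_law \<Otimes>\<^sub>M clock_law)) (A0 \<times> C False \<times> C True)"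
    using cylm by (subst emeasure_distr) (simp_all only: pre measurable_graft space_pair_measure space_clock_law space_exp_law UNIV_Times_UNIV Int_UNIV_right)
  also have "\<dots> = emeasure exp_law A0 * (emeasure clock_law (C False) * emeasure clock_law (C True))"
    by (simp add: C2.emeasure_pair_measure_Times clock_law.emeasure_pair_measure_Times)
  also have "emeasure exp_law A0 = (\<Prod>u\<in>J \<inter> {[]}. emeasure exp_law (A u))"
    using exp_law.emeasure_space_1 by (auto simp: A0_def)
  also have "emeasure clock_law (C False) * emeasure clock_law (C True)
      = (\<Prod>u\<in>(\<lambda>v. v @ [False]) ` S False \<union> (\<lambda>v. v @ [True]) ` S True. emeasure exp_law (A u))"
    using finS by (subst prod.union_disjoint) (auto simp: C prod.reindex inj_on_def)
  also have "(\<Prod>u\<in>J \<inter> {[]}. emeasure exp_law (A u)) * \<dots>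
      = (\<Prod>u\<in>J \<inter> {[]} \<union> ((\<lambda>v. v @ [False]) ` S False \<union> (\<lambda>v. v @ [True]) ` S True). emeasure exp_law (A u))"
    using finS J by (intro prod.union_disjoint[symmetric]) auto
  also have "\<dots> = (\<Prod>u\<in>J. emeasure exp_law (A u))"
    by (simp only: J_eq[symmetric])
  also have "\<dots> = emeasure clock_law {x. \<forall>u\<in>J. x u \<in> A u}"
    by (rule emeasure_clock_law_cylinder[symmetric]) (use J A in auto)
  finally show "emeasure (distr (exp_law \<Otimes>\<^sub>M (clock_law \<Otimes>\<^sub>M clock_law)) clock_law graft)
      (prod_emb UNIV (\<lambda>_. exp_law) J (Pi\<^sub>E J A)) = emeasure clock_law (prod_emb UNIV (\<lambda>_. exp_law) J (Pi\<^sub>E J A))"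
    by (simp add: cyl)
qed (simp_all add: clock_law_def)

lemma nn_integral_clock_law_split:
  assumes h [measurable]: "h \<in> borel_measurable (borel \<Otimes>\<^sub>M (clock_law \<Otimes>\<^sub>M clock_law))"
  shows "(\<integral>\<^sup>+x. h (x [], subclocks False x, subclocks True x) \<partial>clock_law)
       = (\<integral>\<^sup>+a. \<integral>\<^sup>+l. \<integral>\<^sup>+r. h (a, l, r) \<partial>clock_law \<partial>clock_law \<partial>exp_law)"
proof -
  interpret C2: pair_prob_space clock_law clock_law ..
  have "(\<integral>\<^sup>+x. h (x [], subclocks False x, subclocks True x) \<partial>clock_law)
     = (\<integral>\<^sup>+x. h (x [], subclocks False x, subclocks True x)
          \<partial>distr (exp_law \<Otimes>\<^sub>M (clock_law \<Otimes>\<^sub>M clock_law)) clock_law graft)"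
    by (simp add: distr_graft)
  also have "\<dots> = (\<integral>\<^sup>+p. h p \<partial>(exp_law \<Otimes>\<^sub>M (clock_law \<Otimes>\<^sub>M clock_law)))"
    by (subst nn_integral_distr) (auto intro!: nn_integral_cong)
  also have "\<dots> = (\<integral>\<^sup>+a. \<integral>\<^sup>+q. h (a, q) \<partial>(clock_law \<Otimes>\<^sub>M clock_law) \<partial>exp_law)"
    by (subst C2.nn_integral_fst[symmetric]) auto
  also have "\<dots> = (\<integral>\<^sup>+a. \<integral>\<^sup>+l. \<integral>\<^sup>+r. h (a, l, r) \<partial>clock_law \<partial>clock_law \<partial>exp_law)"
    by (intro nn_integral_cong, subst clock_law.nn_integral_fst[symmetric]) auto
  finally show ?thesis .
qed

lemma AE_clock_nonneg: "AE x in clock_law. \<forall>u. 0 \<le> x u"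
proof -
  have "AE a in exp_law. 0 \<le> a"
    unfolding exp_law_def by (subst AE_density) (auto simp: erlang_density_def)
  then have "AE x in clock_law. 0 \<le> x u" for u
    unfolding clock_law_def by (intro AE_PiM_component) (auto intro: prob_space_exp_law)
  then show ?thesis by (simp add: AE_all_countable)
qed

section \<open>First-split decomposition of the population\<close>

abbreviation clock :: "bool list \<Rightarrow> (bool list \<Rightarrow> real) \<Rightarrow> real" where
  "clock \<equiv> (\<lambda>u x. x u)"

lemma birth_time_snoc:
  "birth_time clock (u @ [c]) x = x [] + birth_time clock u (subclocks c x)"
  by (induction u) (auto simp: subclocks_def)

lemma birth_time_nonneg: "(\<And>u. 0 \<le> x u) \<Longrightarrow> 0 \<le> birth_time clock u x"
  by (induction u) auto

lemma alive_before_split: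
  assumes "\<And>u. 0 \<le> x u" "0 \<le> t" "t < x []"
  shows "alive clock t x = {[]}"
proof -
  have nonneg: "0 \<le> birth_time clock u (subclocks c x)" for u c
    using assms(1) by (intro birth_time_nonneg) (simp add: subclocks_def)
  have "t < x [] + birth_time clock u (subclocks c x)" for u c
    using assms(3) nonneg[of u c] by linarith
  then have "u @ [c] \<notin> alive clock t x" for u c
    by (auto simp: alive_def birth_time_snoc not_le)
  moreover have "[] \<in> alive clock t x" using assms by (simp add: alive_def)
  ultimately have "u \<in> alive clock t x \<longleftrightarrow> u = []" for u
    using snoc_cases_bool[of u] by auto
  then show ?thesis by auto
qed

lemma alive_after_split:
  assumes "x [] \<le> t"
  shows "alive clock t x = (\<lambda>u. u @ [False]) ` alive clock (t - x []) (subclocks False x)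
      \<union> (\<lambda>u. u @ [True]) ` alive clock (t - x []) (subclocks True x)"
proof -
  have *: "u @ [c] \<in> alive clock t x \<longleftrightarrow> u \<in> alive clock (t - x []) (subclocks c x)" for u c
    by (auto simp: alive_def birth_time_snoc) (auto simp: subclocks_def)
  have "[] \<notin> alive clock t x" using assms by (simp add: alive_def)
  then have "u \<in> alive clock t x \<longleftrightarrow> u \<in> (\<lambda>u. u @ [False]) ` alive clock (t - x []) (subclocks False x)
      \<union> (\<lambda>u. u @ [True]) ` alive clock (t - x []) (subclocks True x)" for u
    using snoc_cases_bool[of u] by (auto simp: * image_iff)
  then show ?thesis by blast
qed

text \<open>Assigning the weight 0 to infinite populations makes the weight multiplicative over the two
  subtrees after the first split without a case distinction on explosion; for \<open>z = 1\<close> it is the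
  indicator of the event that the population at time \<open>t\<close> is finite.\<close>
definition weight :: "real \<Rightarrow> real \<Rightarrow> (bool list \<Rightarrow> real) \<Rightarrow> ennreal" where
  "weight z t x = (if finite (alive clock t x) then ennreal (z ^ card (alive clock t x)) else 0)"

lemma weight_before_split:
  "(\<And>u. 0 \<le> x u) \<Longrightarrow> 0 \<le> t \<Longrightarrow> t < x [] \<Longrightarrow> weight z t x = ennreal z"
  by (simp add: weight_def alive_before_split)

lemma weight_after_split:
  assumes "x [] \<le> t" "0 \<le> z"
  shows "weight z t x = weight z (t - x []) (subclocks False x) * weight z (t - x []) (subclocks True x)"
proof -
  let ?A = "\<lambda>c. alive clock (t - x []) (subclocks c x)"
  have inj: "inj_on (\<lambda>u. u @ [c]) S" for c :: bool and S by (simp add: inj_on_def)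
  have "finite (alive clock t x) \<longleftrightarrow> finite (?A False) \<and> finite (?A True)"
    by (simp add: alive_after_split[of x t, OF assms(1)] finite_image_iff inj)
  moreover have "card (alive clock t x) = card (?A False) + card (?A True)"
    if "finite (?A False)" "finite (?A True)"
    unfolding alive_after_split[of x t, OF assms(1)] using that
    by (subst card_Un_disjoint) (auto simp: card_image inj)
  ultimately show ?thesis
    using assms(2) by (auto simp: weight_def power_add ennreal_mult)
qed

lemma measurable_birth_time [measurable]: "birth_time clock u \<in> borel_measurable clock_law"
  by (induction u) auto

lemma pred_alive [measurable (raw)]:
  assumes [measurable]: "f \<in> borel_measurable N" "g \<in> N \<rightarrow>\<^sub>M clock_law"
  shows "Measurable.pred N (\<lambda>\<omega>. u \<in> alive clock (f \<omega>) (g \<omega>))"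
proof -
  define b where "b \<omega> = birth_time clock u (g \<omega>)" for \<omega>
  define d where "d \<omega> = g \<omega> u" for \<omega>
  have [measurable]: "b \<in> borel_measurable N" "d \<in> borel_measurable N"
    unfolding b_def d_def by (rule measurable_compose[OF assms(2)], measurable)+
  have "Measurable.pred N (\<lambda>\<omega>. \<not> f \<omega> < b \<omega> \<and> f \<omega> < b \<omega> + d \<omega>)" by measurable
  then show ?thesis by (simp add: alive_def b_def d_def not_less)
qed

lemma measurable_card_alive [measurable (raw)]:
  assumes [measurable]: "f \<in> borel_measurable N" "g \<in> N \<rightarrow>\<^sub>M clock_law"
  shows "(\<lambda>\<omega>. card (alive clock (f \<omega>) (g \<omega>))) \<in> N \<rightarrow>\<^sub>M count_space UNIV"
    and "Measurable.pred N (\<lambda>\<omega>. finite (alive clock (f \<omega>) (g \<omega>)))"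
proof -
  have inj: "inj_on to_nat S" for S :: "bool list set" by (simp add: inj_on_def)
  have [measurable]: "Measurable.pred N (\<lambda>\<omega>. i \<in> to_nat ` alive clock (f \<omega>) (g \<omega>))" for i
    unfolding image_iff Bex_def by measurable
  have "(\<lambda>\<omega>. card (to_nat ` alive clock (f \<omega>) (g \<omega>))) \<in> N \<rightarrow>\<^sub>M count_space UNIV" by measurable
  then show "(\<lambda>\<omega>. card (alive clock (f \<omega>) (g \<omega>))) \<in> N \<rightarrow>\<^sub>M count_space UNIV"
    by (simp add: card_image inj)
  have "Measurable.pred N (\<lambda>\<omega>. finite (to_nat ` alive clock (f \<omega>) (g \<omega>)))" by measurable
  then show "Measurable.pred N (\<lambda>\<omega>. finite (alive clock (f \<omega>) (g \<omega>)))"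
    by (simp add: finite_image_iff inj)
qed

lemma measurable_weight [measurable (raw)]:
  assumes [measurable]: "f \<in> borel_measurable N" "g \<in> N \<rightarrow>\<^sub>M clock_law"
  shows "(\<lambda>\<omega>. weight z (f \<omega>) (g \<omega>)) \<in> borel_measurable N"
  unfolding weight_def by measurable

lemma weight_le_1: "0 \<le> z \<Longrightarrow> z \<le> 1 \<Longrightarrow> weight z t x \<le> 1"
  by (auto simp: weight_def power_le_one)

section \<open>The integral equation of the Yule process\<close>

lemma exp_law_memoryless:
  assumes [measurable]: "h \<in> borel_measurable borel" and s: "0 \<le> s"
  shows "(\<integral>\<^sup>+a. h (a - s) * indicator {s<..} a \<partial>exp_law) = ennreal (exp (- s)) * (\<integral>\<^sup>+a. h a \<partial>exp_law)"
proof -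
  have "(\<integral>\<^sup>+a. h (a - s) * indicator {s<..} a \<partial>exp_law)
      = (\<integral>\<^sup>+a. ennreal (exponential_density 1 a) * (h (a - s) * indicator {s<..} a) \<partial>lborel)"
    unfolding exp_law_def by (subst nn_integral_density) auto
  also have "\<dots> = (\<integral>\<^sup>+a. ennreal (exponential_density 1 (s + a)) * (h a * indicator {s<..} (s + a)) \<partial>lborel)"
    by (subst nn_integral_real_affine[where c=1 and t=s]) auto
  also have "\<dots> = (\<integral>\<^sup>+a. ennreal (exp (- s)) * (ennreal (exponential_density 1 a) * h a) \<partial>lborel)"
  proof (rule nn_integral_cong_AE, rule eventually_mono[OF AE_lborel_singleton[of 0]])
    fix a :: real assume "a \<noteq> 0"
    show "ennreal (exponential_density 1 (s + a)) * (h a * indicator {s<..} (s + a))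
        = ennreal (exp (- s)) * (ennreal (exponential_density 1 a) * h a)"
    proof (cases "0 < a")
      case True
      then have "exponential_density 1 (s + a) = exp (- s) * exponential_density 1 a"
        using s by (simp add: exponential_density_def exp_diff exp_minus field_simps)
      then show ?thesis using True by (simp add: ennreal_mult mult.assoc)
    next
      case False
      with \<open>a \<noteq> 0\<close> show ?thesis by (simp add: exponential_density_def)
    qed
  qed
  also have "\<dots> = ennreal (exp (- s)) * (\<integral>\<^sup>+a. h a \<partial>exp_law)"
    unfolding exp_law_def by (subst nn_integral_density) (auto simp: nn_integral_cmult)
  finally show ?thesis .
qed

text \<open>With \<open>Y t = exp t * U t\<close> the equation becomes \<open>Y t = c + integral {0..t} (\<lambda>r. exp (- r) * (Y r)\<^sup>2)\<close>. Hence
  \<open>Y \<ge> c > 0\<close> is continuous, then differentiable, and \<open>1 / Y t - exp (- t)\<close> has derivative 0.\<close>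
lemma yule_integral_equation:
  fixes U :: "real \<Rightarrow> real"
  assumes U [measurable]: "U \<in> borel_measurable borel" and bound: "\<And>t. 0 \<le> U t" "\<And>t. U t \<le> 1"
    and c: "0 < c" and t: "0 \<le> t"
    and eq: "\<And>t. 0 \<le> t \<Longrightarrow> ennreal (U t) = ennreal (c * exp (- t))
      + (\<integral>\<^sup>+a. indicator {..t} a * (ennreal (U (t - a)) * ennreal (U (t - a))) \<partial>exp_law)"
  shows "U t = c * exp (- t) / (1 - c * (1 - exp (- t)))"
proof -
  define g where "g r = exp r * (U r)\<^sup>2" for r
  define I where "I s = integral {0..s} g" for s
  define Y where "Y s = exp s * U s" for s
  have int: "set_integrable lborel {0..s} g" for s
    unfolding set_integrable_def
  proof (rule integrableI_bounded_set_indicator[where B="exp s"])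
    show "AE r\<in>{0..s} in lborel. norm (g r) \<le> exp s"
    proof (rule AE_I2, rule impI)
      fix r assume "r \<in> {0..s}"
      then have "exp r * (U r)\<^sup>2 \<le> exp s * 1"
        using bound by (intro mult_mono power_le_one) auto
      then show "norm (g r) \<le> exp s" by (simp add: g_def)
    qed
  qed (auto simp: g_def emeasure_lborel_Icc_eq)
  have I_nonneg: "0 \<le> I s" for s
    unfolding I_def using set_borel_integral_eq_integral(1)[OF int[of s]]
    by (rule integral_nonneg) (simp add: g_def)
  have Y_eq: "Y s = c + I s" if s: "0 \<le> s" for s
  proof -
    have "(\<integral>\<^sup>+a. indicator {..s} a * (ennreal (U (s - a)) * ennreal (U (s - a))) \<partial>exp_law)
        = (\<integral>\<^sup>+a. ennreal (exponential_density 1 a) * (indicator {..s} a * (ennreal (U (s - a)) * ennreal (U (s - a)))) \<partial>lborel)"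
      unfolding exp_law_def by (subst nn_integral_density) auto
    also have "\<dots> = (\<integral>\<^sup>+r. ennreal (exponential_density 1 (s - r)) * (indicator {..s} (s - r) * (ennreal (U r) * ennreal (U r))) \<partial>lborel)"
      by (subst nn_integral_real_affine[where c="-1" and t=s]) auto
    also have "\<dots> = (\<integral>\<^sup>+r. ennreal (exp (- s) * (indicator {0..s} r *\<^sub>R g r)) \<partial>lborel)"
      using bound
      by (intro nn_integral_cong) (auto simp: exponential_density_def g_def indicator_def power2_eq_square
         exp_diff exp_minus field_simps simp flip: ennreal_mult)
    also have "\<dots> = ennreal (\<integral>r. exp (- s) * (indicator {0..s} r *\<^sub>R g r) \<partial>lborel)"
      using int[of s] unfolding set_integrable_def
      by (intro nn_integral_eq_integral integrable_mult_right) (auto simp: g_def)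
    also have "(\<integral>r. exp (- s) * (indicator {0..s} r *\<^sub>R g r) \<partial>lborel) = exp (- s) * I s"
      using set_borel_integral_eq_integral(2)[OF int[of s]]
      by (simp add: I_def set_lebesgue_integral_def)
    finally have "ennreal (U s) = ennreal (c * exp (- s)) + ennreal (exp (- s) * I s)"
      using eq[OF s] by simp
    then have "U s = c * exp (- s) + exp (- s) * I s"
      using c bound I_nonneg[of s] by (simp flip: ennreal_plus)
    then show ?thesis by (simp add: Y_def algebra_simps exp_minus)
  qed
  have Y_pos: "0 < Y s" if "0 \<le> s" for s
    using Y_eq[OF that] I_nonneg[of s] c by simp
  have g_Y: "g r = exp (- r) * (Y r)\<^sup>2" for r
    by (simp add: g_def Y_def power2_eq_square exp_minus)
  have "continuous_on {0..t} I"
    unfolding I_def using set_borel_integral_eq_integral(1)[OF int] by (rule indefinite_integral_continuous_1)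
  then have "continuous_on {0..t} Y"
    by (subst continuous_on_cong[OF refl Y_eq]) (auto intro!: continuous_intros)
  then have "continuous_on {0..t} g"
    unfolding g_Y by (intro continuous_intros)
  then have I_deriv: "(I has_real_derivative g r) (at r within {0..t})" if "r \<in> {0..t}" for r
    using integral_has_vector_derivative[OF _ that] unfolding I_def
    by (simp add: has_real_derivative_iff_has_vector_derivative)
  have Y_deriv: "(Y has_real_derivative g r) (at r within {0..t})" if "r \<in> {0..t}" for r
  proof (rule has_field_derivative_transform_within[OF _ zero_less_one that])
    show "((\<lambda>s. c + I s) has_real_derivative g r) (at r within {0..t})"
      using I_deriv[OF that] by (auto intro!: derivative_eq_intros)
  qed (use Y_eq in auto)
  have "((\<lambda>s. inverse (Y s) - exp (- s)) has_real_derivative 0) (at r within {0..t})" if "r \<in> {0..t}" for r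
    using Y_pos[of r] that
    by (auto intro!: derivative_eq_intros Y_deriv simp: g_Y power2_eq_square)
  then obtain k where k: "inverse (Y s) - exp (- s) = k" if "s \<in> {0..t}" for s
    using has_field_derivative_zero_constant[of "{0..t}" "\<lambda>s. inverse (Y s) - exp (- s)"] by auto
  have "Y 0 = c" using Y_eq[of 0] by (simp add: I_def)
  then have "inverse (Y t) - exp (- t) = inverse c - 1"
    using k[of 0] k[of t] t by simp
  then have "Y t = inverse (inverse c - 1 + exp (- t))"
    by (metis add.commute diff_add_cancel inverse_inverse_eq)
  moreover have "U t = exp (- t) * Y t"
    by (simp add: Y_def exp_minus)
  moreover have "inverse (inverse c - 1 + exp (- t)) = c / (1 - c * (1 - exp (- t)))"
  proof -
    have "inverse c - 1 + exp (- t) = (1 - c * (1 - exp (- t))) / c" using c by (simp add: field_simps)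
    then show ?thesis by simp
  qed
  ultimately show ?thesis by simp
qed

text \<open>A functional that is multiplicative over the two subtrees after the first split has an
  expectation solving the Yule equation. The contribution of the event that the initial particle
  is still alive enters only through \<open>c\<close>, so different functionals \<open>w\<close> share one explicit solution.\<close>
lemma nn_integral_branching_functional:
  fixes w :: "real \<Rightarrow> (bool list \<Rightarrow> real) \<Rightarrow> ennreal"
  assumes meas: "(\<lambda>p. w (fst p) (snd p)) \<in> borel_measurable (borel \<Otimes>\<^sub>M clock_law)"
    and le_1: "\<And>s x. w s x \<le> 1"
    and branch: "\<And>s x. x [] \<le> s \<Longrightarrow>
        w s x = w (s - x []) (subclocks False x) * w (s - x []) (subclocks True x)"
    and root: "\<And>s. 0 \<le> s \<Longrightarrow> (\<integral>\<^sup>+x. w s x * indicator {s<..} (x []) \<partial>clock_law) = ennreal (c * exp (- s))"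
    and c: "0 < c" and t: "0 \<le> t"
  shows "(\<integral>\<^sup>+x. w t x \<partial>clock_law) = ennreal (c * exp (- t) / (1 - c * (1 - exp (- t))))"
proof -
  have w2 [measurable (raw)]: "(\<lambda>\<omega>. w (f \<omega>) (g \<omega>)) \<in> borel_measurable N"
    if [measurable]: "f \<in> borel_measurable N" "g \<in> N \<rightarrow>\<^sub>M clock_law" for f g
      and N :: "(real \<times> (bool list \<Rightarrow> real) \<times> (bool list \<Rightarrow> real)) measure"
    using measurable_compose[OF measurable_Pair[OF that] meas] by simp
  have w3 [measurable]: "w s \<in> borel_measurable clock_law" for s
    using measurable_compose[OF _ meas, of "\<lambda>x. (s, x)" clock_law] by simp
  define V where "V s = (\<integral>\<^sup>+x. w s x \<partial>clock_law)" for s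
  have V_le: "V s \<le> 1" for s
    unfolding V_def using nn_integral_mono[of clock_law "w s" "\<lambda>_. 1"] le_1 clock_law.emeasure_space_1 by simp
  have V_meas [measurable]: "V \<in> borel_measurable borel"
    unfolding V_def using clock_law.borel_measurable_nn_integral_fst[OF meas] by simp
  have V_fin: "V s < \<top>" for s using V_le[of s] by (simp add: order_le_less_trans)
  define U where "U s = enn2real (V s)" for s
  have V_U: "V s = ennreal (U s)" for s
    unfolding U_def using V_fin by simp
  have "U t = c * exp (- t) / (1 - c * (1 - exp (- t)))"
  proof (rule yule_integral_equation)
    show "U \<in> borel_measurable borel" unfolding U_def by measurable
    show "0 \<le> U s" "U s \<le> 1" for s
      using V_le[of s] by (auto simp: U_def intro: enn2real_leI)
    fix s :: real assume s: "0 \<le> s"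
    define h where "h = (\<lambda>(a, l, r). indicator {..s} a * (w (s - a) l * w (s - a) r))"
    have [measurable]: "h \<in> borel_measurable (borel \<Otimes>\<^sub>M (clock_law \<Otimes>\<^sub>M clock_law))"
      unfolding h_def split_beta' by measurable
    have "V s = (\<integral>\<^sup>+x. w s x * indicator {s<..} (x []) + h (x [], subclocks False x, subclocks True x) \<partial>clock_law)"
      unfolding V_def h_def by (intro nn_integral_cong) (auto simp: branch split: split_indicator)
    also have "\<dots> = ennreal (c * exp (- s)) + (\<integral>\<^sup>+x. h (x [], subclocks False x, subclocks True x) \<partial>clock_law)"
      by (subst nn_integral_add) (auto simp: root[OF s])
    also have "(\<integral>\<^sup>+x. h (x [], subclocks False x, subclocks True x) \<partial>clock_law)
        = (\<integral>\<^sup>+a. \<integral>\<^sup>+l. \<integral>\<^sup>+r. indicator {..s} a * (w (s - a) l * w (s - a) r) \<partial>clock_law \<partial>clock_law \<partial>exp_law)"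
      by (subst nn_integral_clock_law_split) (auto simp: h_def)
    also have "\<dots> = (\<integral>\<^sup>+a. indicator {..s} a * (V (s - a) * V (s - a)) \<partial>exp_law)"
      by (intro nn_integral_cong) (simp add: nn_integral_cmult nn_integral_multc V_def)
    finally show "ennreal (U s) = ennreal (c * exp (- s))
      + (\<integral>\<^sup>+a. indicator {..s} a * (ennreal (U (s - a)) * ennreal (U (s - a))) \<partial>exp_law)"
      by (simp add: V_U)
  qed (use c t in auto)
  then show ?thesis using V_U[of t] by (simp add: V_def)
qed

lemma AE_weight_before_split:
  "0 \<le> t \<Longrightarrow> AE x in clock_law. t < x [] \<longrightarrow> weight z t x = ennreal z"
  using AE_clock_nonneg by eventually_elim (simp add: weight_before_split)

lemma nn_integral_clock_root:
  assumes [measurable]: "h \<in> borel_measurable borel"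
  shows "(\<integral>\<^sup>+x. h (x []) \<partial>clock_law) = (\<integral>\<^sup>+a. h a \<partial>exp_law)"
  using nn_integral_clock_law_split[of "\<lambda>p. h (fst p)"] clock_law.emeasure_space_1 by simp

lemma root_survival:
  "0 \<le> t \<Longrightarrow> (\<integral>\<^sup>+x. indicator {t<..} (x []) \<partial>clock_law) = ennreal (exp (- t))"
  using nn_integral_clock_root[of "indicator {t<..}"] exp_law_memoryless[of "\<lambda>_. 1" t] exp_law.emeasure_space_1
  by simp

text \<open>Given that the initial particle survives time \<open>t\<close>, its residual lifetime is again
  exponential, so that the population at time \<open>t + d\<close> looks like a fresh one at time \<open>d\<close>.\<close>
lemma weight_memoryless:
  assumes z: "0 \<le> z" and t: "0 \<le> t" and d: "0 \<le> d"
  shows "(\<integral>\<^sup>+x. weight z (t + d) x * indicator {t<..} (x []) \<partial>clock_law)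
       = ennreal (exp (- t)) * (\<integral>\<^sup>+x. weight z d x \<partial>clock_law)"
proof -
  define H where "H = (\<lambda>(a, l, r). if d < a then ennreal z else weight z (d - a) l * weight z (d - a) r)"
  have H [measurable]: "H \<in> borel_measurable (borel \<Otimes>\<^sub>M (clock_law \<Otimes>\<^sub>M clock_law))"
    unfolding H_def split_beta' by measurable
  define G where "G a = (\<integral>\<^sup>+l. \<integral>\<^sup>+r. H (a, l, r) \<partial>clock_law \<partial>clock_law)" for a
  have [measurable]: "G \<in> borel_measurable borel" unfolding G_def by measurable
  have w: "AE x in clock_law. weight z (s + d) x = H (x [] - s, subclocks False x, subclocks True x)"
    if "0 \<le> s" for s
  proof -
    have "0 \<le> s + d" using that d by simp
    from AE_weight_before_split[OF this, of z] show ?thesis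
    by eventually_elim (use that d z in \<open>auto simp: H_def weight_after_split algebra_simps\<close>)
  qed
  have "(\<integral>\<^sup>+x. weight z (t + d) x * indicator {t<..} (x []) \<partial>clock_law)
     = (\<integral>\<^sup>+x. (\<lambda>(a, l, r). H (a - t, l, r) * indicator {t<..} a) (x [], subclocks False x, subclocks True x) \<partial>clock_law)"
    by (rule nn_integral_cong_AE[OF eventually_mono[OF w[OF t]]]) simp
  also have "\<dots> = (\<integral>\<^sup>+a. G (a - t) * indicator {t<..} a \<partial>exp_law)"
    by (subst nn_integral_clock_law_split) (auto simp: G_def split_beta' nn_integral_multc)
  also have "\<dots> = ennreal (exp (- t)) * (\<integral>\<^sup>+a. G a \<partial>exp_law)"
    by (rule exp_law_memoryless) (auto simp: t)
  also have "(\<integral>\<^sup>+a. G a \<partial>exp_law) = (\<integral>\<^sup>+x. H (x [], subclocks False x, subclocks True x) \<partial>clock_law)"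
    by (subst nn_integral_clock_law_split) (auto simp: G_def intro!: nn_integral_cong)
  also have "\<dots> = (\<integral>\<^sup>+x. weight z d x \<partial>clock_law)"
    by (rule nn_integral_cong_AE[OF eventually_mono[OF w[of 0]]]) simp_all
  finally show ?thesis .
qed

section \<open>Probability generating functions of the population size\<close>

definition yule_pgf :: "real \<Rightarrow> real \<Rightarrow> real" where
  "yule_pgf t z = z * exp (- t) / (1 - z * (1 - exp (- t)))"

lemma yule_pgf_pos:
  assumes "0 < z" "z \<le> 1" "0 \<le> t" shows "0 < yule_pgf t z"
proof -
  have "z * (1 - exp (- t)) \<le> 1 - exp (- t)" using assms by (intro mult_left_le_one_le) auto
  also have "\<dots> < 1" by simp
  finally show ?thesis using assms by (simp add: yule_pgf_def)
qed

lemma yule_pgf_le: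
  assumes "0 < z" "z \<le> 1" "0 \<le> t" shows "yule_pgf t z \<le> z"
proof -
  have "z * (1 - exp (- t)) \<le> 1 - exp (- t)" using assms by (intro mult_left_le_one_le) auto
  then have "exp (- t) \<le> 1 - z * (1 - exp (- t))" by simp
  then show ?thesis using assms
    by (simp add: yule_pgf_def divide_le_eq) (smt (verit) exp_gt_zero mult_left_mono)
qed

lemma nn_integral_weight:
  assumes z: "0 < z" "z \<le> 1" and t: "0 \<le> t"
  shows "(\<integral>\<^sup>+x. weight z t x \<partial>clock_law) = ennreal (yule_pgf t z)"
  unfolding yule_pgf_def
proof (rule nn_integral_branching_functional)
  show "(\<integral>\<^sup>+x. weight z s x * indicator {s<..} (x []) \<partial>clock_law) = ennreal (z * exp (- s))" if "0 \<le> s" for s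
  proof -
    have "(\<integral>\<^sup>+x. weight z s x * indicator {s<..} (x []) \<partial>clock_law)
        = (\<integral>\<^sup>+x. ennreal z * indicator {s<..} (x []) \<partial>clock_law)"
      by (rule nn_integral_cong_AE[OF eventually_mono[OF AE_weight_before_split[OF that, of z]]])
        (auto split: split_indicator)
    then show ?thesis
      using z by (simp add: nn_integral_cmult root_survival that ennreal_mult)
  qed
qed (use z t in \<open>auto simp: weight_le_1 intro!: weight_after_split\<close>)

text \<open>For fixed \<open>d\<close> the product \<open>weight z t x * weight q (t + d) x\<close> factorizes over the two subtrees
  after the first split. If the initial particle is still alive at time \<open>t\<close>, it contributes \<open>z\<close> at time \<open>t\<close> and, by lack of memory,
  \<open>yule_pgf d q\<close> at time \<open>t + d\<close>; so \<open>c = z * yule_pgf d q\<close>.\<close>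
lemma nn_integral_weight_two_times:
  assumes z: "0 < z" "z \<le> 1" and q: "0 < q" "q \<le> 1" and t: "0 \<le> t" and d: "0 \<le> d"
  shows "(\<integral>\<^sup>+x. weight z t x * weight q (t + d) x \<partial>clock_law) = ennreal (yule_pgf t (z * yule_pgf d q))"
  unfolding yule_pgf_def[of t]
proof (rule nn_integral_branching_functional)
  show "(\<integral>\<^sup>+x. weight z s x * weight q (s + d) x * indicator {s<..} (x []) \<partial>clock_law)
      = ennreal (z * yule_pgf d q * exp (- s))" if s: "0 \<le> s" for s
  proof -
    have "(\<integral>\<^sup>+x. weight z s x * weight q (s + d) x * indicator {s<..} (x []) \<partial>clock_law)
        = (\<integral>\<^sup>+x. ennreal z * (weight q (s + d) x * indicator {s<..} (x [])) \<partial>clock_law)"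
      by (rule nn_integral_cong_AE[OF eventually_mono[OF AE_weight_before_split[OF s, of z]]])
        (auto split: split_indicator)
    also have "\<dots> = ennreal z * (ennreal (exp (- s)) * ennreal (yule_pgf d q))"
      using q s d by (simp add: nn_integral_cmult weight_memoryless nn_integral_weight)
    finally show ?thesis
      using z yule_pgf_pos[OF q d] by (simp add: ennreal_mult mult_ac)
  qed
  show "weight z s x * weight q (s + d) x \<le> 1" for s x
    using mult_mono[OF weight_le_1[of z s x] weight_le_1[of q "s + d" x]] z q by simp
  show "weight z s x * weight q (s + d) x
     = weight z (s - x []) (subclocks False x) * weight q (s - x [] + d) (subclocks False x) *
       (weight z (s - x []) (subclocks True x) * weight q (s - x [] + d) (subclocks True x))"
    if "x [] \<le> s" for s x
  proof -
    have shift: "s + d - x [] = s - x [] + d" by simp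
    show ?thesis
      using that d z q weight_after_split[of x s z] weight_after_split[of x "s + d" q, unfolded shift]
      by (simp add: mult_ac del: add_diff_eq)
  qed
qed (use z q t yule_pgf_pos[OF q d] in auto)

text \<open>For \<open>z = 1\<close> the weight is the indicator of a finite population and its expectation is 1, so the
  process does not explode.\<close>
lemma AE_alive_finite:
  assumes "0 \<le> t" shows "AE x in clock_law. finite (alive clock t x)"
proof -
  have "emeasure clock_law {x \<in> space clock_law. finite (alive clock t x)}
      = (\<integral>\<^sup>+x. weight 1 t x \<partial>clock_law)"
    by (subst nn_integral_indicator[symmetric], measurable)
       (intro nn_integral_cong, simp add: weight_def)
  also have "\<dots> = 1"
    using nn_integral_weight[of 1 t] assms by (simp add: yule_pgf_def)
  finally show ?thesis
    by (intro clock_law.AE_I_eq_1) measurable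
qed

text \<open>The probability of a finite empty population is at most the generating function at \<open>z\<close>, which
  does not exceed \<open>z\<close>; and \<open>z > 0\<close> is arbitrary.\<close>
lemma AE_alive_nonempty:
  assumes t: "0 \<le> t" shows "AE x in clock_law. card (alive clock t x) > 0"
proof -
  let ?A = "{x \<in> space clock_law. finite (alive clock t x) \<and> card (alive clock t x) = 0}"
  have [measurable]: "?A \<in> sets clock_law" by measurable
  have "emeasure clock_law ?A \<le> ennreal z" if z: "0 < z" "z \<le> 1" for z
  proof -
    have "emeasure clock_law ?A \<le> (\<integral>\<^sup>+x. weight z t x \<partial>clock_law)"
      by (subst nn_integral_indicator[symmetric], measurable)
         (intro nn_integral_mono, auto simp: weight_def split: split_indicator)
    also have "\<dots> \<le> ennreal z"
      using yule_pgf_le[OF z t] by (simp add: nn_integral_weight z t ennreal_leI)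
    finally show ?thesis .
  qed
  then have le: "measure clock_law ?A \<le> z" if "0 < z" "z \<le> 1" for z
    using that by (simp add: clock_law.emeasure_eq_measure)
  have "measure clock_law ?A \<le> 0"
  proof (rule field_le_epsilon)
    fix e :: real assume "0 < e"
    then show "measure clock_law ?A \<le> 0 + e" using le[of "min e 1"] by simp
  qed
  then have "emeasure clock_law ?A = 0"
    by (simp add: clock_law.emeasure_eq_measure measure_le_0_iff)
  then have "AE x in clock_law. \<not> (finite (alive clock t x) \<and> card (alive clock t x) = 0)"
    by (rule AE_I[where N="?A", rotated]) (fact | auto)+
  with AE_alive_finite[OF t] show ?thesis by eventually_elim auto
qed

text \<open>The law of a branching process forms a semigroup under composition of generating functions.
  In the tilted law this identifies the normalizing constant.\<close>
lemma yule_pgf_semigroup: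
  assumes q: "0 < q" "q \<le> 1" and "0 \<le> s" "0 \<le> d"
  shows "yule_pgf s (yule_pgf d q) = yule_pgf (s + d) q"
proof -
  define E where "E = exp (- d)"
  define S where "S = exp (- s)"
  have ES: "0 < E" "0 < S" by (auto simp: E_def S_def)
  have D: "0 < 1 - q * (1 - E)"
  proof -
    have "0 < q * E" using q ES by simp
    then show ?thesis using q by (simp add: algebra_simps)
  qed
  have "1 - q * E / (1 - q * (1 - E)) * (1 - S) = (1 - q * (1 - E * S)) / (1 - q * (1 - E))"
    using D by (simp add: field_simps)
  moreover have "exp (- (s + d)) = E * S" by (simp add: E_def S_def exp_add[symmetric])
  ultimately show ?thesis
    using D by (simp add: yule_pgf_def flip: E_def S_def)
qed

section \<open>Geometric laws and generating functions\<close>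

text \<open>Once the coefficients below \<open>n\<close> are known to vanish, dividing by \<open>z ^ n\<close> and letting \<open>z\<close> decrease
  to 0 isolates \<open>a n\<close>.\<close>
lemma powser_eq_0_imp_coeff_0:
  fixes a :: "nat \<Rightarrow> real"
  assumes sums: "\<And>z. 0 < z \<Longrightarrow> z < 1 \<Longrightarrow> (\<lambda>n. a n * z ^ n) sums 0"
  shows "a n = 0"
proof (induction n rule: less_induct)
  case (less n)
  define b where "b j = a (j + n)" for j
  have b0: "(\<lambda>j. b j * z ^ j) sums 0" if z: "0 < z" "z < 1" for z
  proof -
    have "(\<lambda>j. a (j + n) * z ^ (j + n)) sums (0 - (\<Sum>j<n. a j * z ^ j))"
      using sums_split_initial_segment[OF sums[OF z], of n] by simp
    also have "(\<Sum>j<n. a j * z ^ j) = 0" using less by simp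
    finally have "(\<lambda>j. z ^ n * (b j * z ^ j)) sums (z ^ n * 0)"
      by (simp add: b_def power_add mult_ac)
    then show ?thesis using z by (subst (asm) sums_mult_iff) auto
  qed
  have "summable (\<lambda>j. b j * z ^ j)" if "norm z < 1" for z
  proof (rule powser_inside)
    show "summable (\<lambda>j. b j * ((1 + norm z) / 2) ^ j)"
      using b0[of "(1 + norm z) / 2"] that by (auto simp: sums_iff)
    show "norm z < norm ((1 + norm z) / 2)" using that by simp
  qed
  then have "((\<lambda>z. \<Sum>j. b j * z ^ j) \<longlongrightarrow> b 0) (at 0)"
    by (intro powser_limit_0[of 1]) (auto intro: summable_sums)
  then have "((\<lambda>z. \<Sum>j. b j * z ^ j) \<longlongrightarrow> b 0) (at_right 0)"
    by (rule tendsto_within_subset) auto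
  moreover have "((\<lambda>z. \<Sum>j. b j * z ^ j) \<longlongrightarrow> 0) (at_right 0)"
  proof (rule tendsto_eventually)
    have "eventually (\<lambda>z::real. z \<in> {0<..<1}) (at_right 0)"
      by (rule eventually_at_right_real) simp
    then show "eventually (\<lambda>z. (\<Sum>j. b j * z ^ j) = 0) (at_right 0)"
      by eventually_elim (use b0 in \<open>auto simp: sums_iff\<close>)
  qed
  ultimately have "b 0 = 0"
    using tendsto_unique[OF trivial_limit_at_right_real] by blast
  then show ?case by (simp add: b_def)
qed

lemma nn_integral_nat_measure:
  fixes \<mu> :: "nat measure"
  assumes [measurable_cong, simp]: "sets \<mu> = UNIV"
  shows "(\<integral>\<^sup>+k. f k \<partial>\<mu>) = (\<Sum>k. f k * emeasure \<mu> {k})"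
proof -
  have [simp]: "space \<mu> = UNIV" using sets_eq_imp_space_eq[of \<mu> "count_space UNIV"] by simp
  have m: "g \<in> borel_measurable \<mu>" for g :: "nat \<Rightarrow> ennreal" by (simp add: measurable_def)
  have "f k = (\<Sum>j. f j * indicator {j} k)" for k
  proof -
    have "(\<lambda>j. f j * indicator {j} k) = (\<lambda>j. if j = k then f j else 0)" by auto
    then show ?thesis using sums_unique[OF sums_single[of k f]] by simp
  qed
  then have "(\<integral>\<^sup>+k. f k \<partial>\<mu>) = (\<integral>\<^sup>+k. (\<Sum>j. f j * indicator {j} k) \<partial>\<mu>)"
    by (rule nn_integral_cong)
  also have "\<dots> = (\<Sum>j. \<integral>\<^sup>+k. f j * indicator {j} k \<partial>\<mu>)"
    by (rule nn_integral_suminf) (rule m)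
  also have "\<dots> = (\<Sum>k. f k * emeasure \<mu> {k})"
    by (simp add: nn_integral_cmult_indicator)
  finally show ?thesis .
qed

lemma nat_measure_eqI_pgf:
  fixes \<mu> \<nu> :: "nat measure"
  assumes sets [simp]: "sets \<mu> = UNIV" "sets \<nu> = UNIV"
    and fin: "finite_measure \<mu>" "finite_measure \<nu>"
    and pgf: "\<And>z. 0 < z \<Longrightarrow> z < 1 \<Longrightarrow> (\<integral>\<^sup>+k. ennreal (z ^ k) \<partial>\<mu>) = (\<integral>\<^sup>+k. ennreal (z ^ k) \<partial>\<nu>)"
  shows "\<mu> = \<nu>"
proof -
  have sums: "(\<lambda>k. measure \<kappa> {k} * z ^ k) sums enn2real (\<integral>\<^sup>+k. ennreal (z ^ k) \<partial>\<kappa>)"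
    if k: "sets \<kappa> = UNIV" "finite_measure \<kappa>" and z: "0 < z" "z < 1" for \<kappa> :: "nat measure" and z :: real
  proof -
    interpret finite_measure \<kappa> by fact
    have s: "summable (\<lambda>k. measure \<kappa> {k} * z ^ k)"
    proof (rule summable_comparison_test')
      show "summable (\<lambda>k. measure \<kappa> (space \<kappa>) * z ^ k)"
        using z by (intro summable_mult summable_geometric) simp
      show "norm (measure \<kappa> {k} * z ^ k) \<le> measure \<kappa> (space \<kappa>) * z ^ k" for k
        using z by (simp add: abs_mult mult_right_mono bounded_measure)
    qed
    have "(\<integral>\<^sup>+k. ennreal (z ^ k) \<partial>\<kappa>) = (\<Sum>k. ennreal (measure \<kappa> {k} * z ^ k))"
      using z by (simp add: nn_integral_nat_measure[OF k(1)] emeasure_eq_measure ennreal_mult mult.commute)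
    also have "\<dots> = ennreal (\<Sum>k. measure \<kappa> {k} * z ^ k)"
      using z s by (intro suminf_ennreal2) auto
    finally show ?thesis
      using s z by (simp add: sums_iff suminf_nonneg)
  qed
  have "(\<lambda>k. (measure \<mu> {k} - measure \<nu> {k}) * z ^ k) sums 0" if "0 < z" "z < 1" for z :: real
    using sums_diff[OF sums[OF sets(1) fin(1) that] sums[OF sets(2) fin(2) that]] pgf[OF that]
    by (simp add: left_diff_distrib)
  then have "measure \<mu> {k} - measure \<nu> {k} = 0" for k
    by (rule powser_eq_0_imp_coeff_0)
  then have "emeasure \<mu> {k} = emeasure \<nu> {k}" for k
    by (simp add: finite_measure.emeasure_eq_measure[OF fin(1)] finite_measure.emeasure_eq_measure[OF fin(2)])
  then show ?thesis
    by (intro measure_eqI_countable[of _ UNIV]) auto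
qed

lemma pgf_geometric1_pmf:
  assumes p: "0 < p" "p \<le> 1" and z: "0 < z" "z < 1"
  shows "(\<integral>\<^sup>+k. ennreal (z ^ k) \<partial>geometric1_pmf p) = ennreal (p * z / (1 - (1 - p) * z))"
proof -
  have "(1 - p) * z \<le> 1 * z" using p z by (intro mult_right_mono) auto
  then have lt: "(1 - p) * z < 1" using z by linarith
  have "(\<integral>\<^sup>+k. ennreal (z ^ k) \<partial>geometric1_pmf p) = (\<integral>\<^sup>+k. ennreal (z ^ Suc k) \<partial>geometric_pmf p)"
    unfolding geometric1_pmf_def by (rule nn_integral_map_pmf)
  also have "\<dots> = (\<Sum>k. ennreal ((1 - p) ^ k * p) * ennreal (z ^ Suc k))"
    using p by (simp add: nn_integral_measure_pmf nn_integral_count_space_nat)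
  also have "\<dots> = (\<Sum>k. ennreal (p * z * ((1 - p) * z) ^ k))"
    using p z by (simp add: ennreal_mult[symmetric] power_mult_distrib mult_ac)
  also have "\<dots> = ennreal (p * z * (1 / (1 - (1 - p) * z)))"
  proof (rule suminf_ennreal_eq)
    show "(\<lambda>k. p * z * ((1 - p) * z) ^ k) sums (p * z * (1 / (1 - (1 - p) * z)))"
      using lt p z by (intro sums_mult geometric_sums) simp
  qed (use p z in auto)
  finally show ?thesis by simp
qed

text \<open>The distribution function of a law on the natural numbers is a finite sum of point probabilities, and
  those of the geometric law are polynomials in the parameter.\<close>
lemma weak_conv_geometric1:
  assumes p: "(p \<longlongrightarrow> p0) at_top" and p0: "0 < p0" "p0 \<le> 1"
    and ev: "eventually (\<lambda>t. 0 < p t \<and> p t \<le> 1 \<and>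
      \<mu> t = distr (measure_pmf (geometric1_pmf (p t))) borel real) at_top"
  shows "weak_conv_at_top \<mu> (distr (measure_pmf (geometric1_pmf p0)) borel real)"
  unfolding weak_conv_at_top_def
proof (intro allI impI)
  fix x :: real
  define K where "K = {k. real k \<le> x}"
  have "K \<subseteq> {..nat \<lfloor>x\<rfloor>}" by (auto simp: K_def le_nat_floor)
  then have K: "finite K" by (rule finite_subset) simp
  have cdf: "cdf (distr (measure_pmf (geometric1_pmf q)) borel real) x
      = (\<Sum>k\<in>K. if k = 0 then 0 else q * (1 - q) ^ (k - 1))" if "0 < q" "q \<le> 1" for q
  proof -
    have "real -` {..x} = K" by (auto simp: K_def)
    then show ?thesis
      using K that by (simp add: cdf_def measure_distr measure_measure_pmf_finite pmf_geometric1)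
  qed
  have "((\<lambda>t. \<Sum>k\<in>K. if k = 0 then 0 else p t * (1 - p t) ^ (k - 1))
      \<longlongrightarrow> (\<Sum>k\<in>K. if k = 0 then 0 else p0 * (1 - p0) ^ (k - 1))) at_top"
    by (intro tendsto_sum) (auto intro!: tendsto_intros p)
  moreover have "eventually (\<lambda>t. (\<Sum>k\<in>K. if k = 0 then 0 else p t * (1 - p t) ^ (k - 1)) = cdf (\<mu> t) x) at_top"
    using ev by eventually_elim (simp add: cdf)
  ultimately show "((\<lambda>t. cdf (\<mu> t) x) \<longlongrightarrow> cdf (distr (measure_pmf (geometric1_pmf p0)) borel real) x) at_top"
    unfolding cdf[OF p0] by (rule Lim_transform_eventually)
qed

section \<open>Population size under the tilted law\<close>

lemma repulsion_bounds:
  assumes "0 < lam" "0 < eps"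
  shows "0 < repulsion lam eps" "repulsion lam eps < 1"
proof -
  have "cosh (eps * sqrt (2 * lam)) > 1"
    using cosh_real_nonneg_less_iff[of 0 "eps * sqrt (2 * lam)"] assms by simp
  then show "0 < repulsion lam eps" "repulsion lam eps < 1"
    by (simp_all add: repulsion_def sech_def)
qed

lemma alive_clock: "alive T t \<omega> = alive clock t (\<lambda>u. T u \<omega>)"
proof -
  have "birth_time T u \<omega> = birth_time clock u (\<lambda>u. T u \<omega>)" for u by (induction u) auto
  then show ?thesis by (simp add: alive_def)
qed

lemma num_particles_clock: "num_particles T B t \<omega> = card (alive clock t (\<lambda>u. T u \<omega>))"
  unfolding num_particles_def particles_def alive_clock[symmetric]
  by (rule card_image) (simp add: inj_on_def)

context branching_brownian_motion
begin

lemma measurable_T [measurable]: "T u \<in> borel_measurable M"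
  using distributed_measurable[OF lifetimes[of u]] by simp

lemma measurable_lifetimes [measurable]: "(\<lambda>\<omega> u. T u \<omega>) \<in> M \<rightarrow>\<^sub>M clock_law"
proof -
  have "(\<lambda>\<omega> u. T u \<omega>) \<in> M \<rightarrow>\<^sub>M Pi\<^sub>M UNIV (\<lambda>_. borel)"
    by (rule measurable_PiM_single') (auto simp: space_PiM)
  then show ?thesis by (simp add: sets_clock_law cong: measurable_cong_sets)
qed

lemma indep_lifetimes: "indep_vars (\<lambda>_. borel) T UNIV"
  unfolding indep_vars_def2
proof (intro conjI ballI)
  show "indep_sets (\<lambda>u. {T u -` A \<inter> space M | A. A \<in> sets borel}) UNIV"
  proof (rule indep_setsI)
    fix J :: "bool list set" and A
    assume J: "J \<noteq> {}" "finite J" and A: "\<forall>u\<in>J. A u \<in> {T u -` A \<inter> space M | A. A \<in> sets borel}"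
    have "prob (\<Inter>j\<in>Inl ` J. case_sum A (\<lambda>_::bool list. {}) j) = (\<Prod>j\<in>Inl ` J. prob (case_sum A (\<lambda>_::bool list. {}) j))"
      using J A by (intro indep_setsD[OF independence]) auto
    then show "prob (\<Inter>u\<in>J. A u) = (\<Prod>u\<in>J. prob (A u))"
      by (simp add: prod.reindex)
  qed auto
qed simp

text \<open>Only the lifetimes matter for the number of particles, so every expectation below can be
  computed under \<^const>\<open>clock_law\<close>.\<close>
lemma distr_lifetimes: "distr M clock_law (\<lambda>\<omega> u. T u \<omega>) = clock_law"
proof -
  have law: "distr M borel (T u) = exp_law" for u
  proof -
    have "distr M borel (T u) = distr M lborel (T u)" by (rule distr_cong) simp_all
    then show ?thesis using distributed_distr_eq_density[OF lifetimes[of u]] by (simp add: exp_law_def)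
  qed
  have "distr M clock_law (\<lambda>\<omega> u. T u \<omega>) = distr M (Pi\<^sub>M UNIV (\<lambda>_. borel)) (\<lambda>\<omega>. \<lambda>u\<in>UNIV. T u \<omega>)"
    by (rule distr_cong) (auto simp: sets_clock_law)
  also have "\<dots> = Pi\<^sub>M UNIV (\<lambda>u. distr M borel (T u))"
    using indep_lifetimes by (subst (asm) indep_vars_iff_distr_eq_PiM) auto
  also have "\<dots> = clock_law" by (simp add: law clock_law_def)
  finally show ?thesis .
qed

lemma measurable_num_particles [measurable]: "num_particles T B t \<in> M \<rightarrow>\<^sub>M count_space UNIV"
  unfolding num_particles_clock[abs_def] by measurable

lemma AE_lifetimes:
  assumes "AE x in clock_law. P x" shows "AE \<omega> in M. P (\<lambda>u. T u \<omega>)"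
  using assms by (subst (asm) distr_lifetimes[symmetric]) (rule AE_distrD[OF measurable_lifetimes])

lemma AE_num_particles_pos: "0 \<le> t \<Longrightarrow> AE \<omega> in M. num_particles T B t \<omega> > 0"
  unfolding num_particles_clock by (rule AE_lifetimes[OF AE_alive_nonempty])

lemma joint_pgf:
  assumes z: "0 < z" "z \<le> 1" and q: "0 < q" "q \<le> 1" and s: "0 \<le> s" "s \<le> t"
  shows "(\<integral>\<^sup>+\<omega>. ennreal (z ^ num_particles T B s \<omega> * q ^ num_particles T B t \<omega>) \<partial>M)
      = ennreal (yule_pgf s (z * yule_pgf (t - s) q))"
proof -
  have "(\<integral>\<^sup>+\<omega>. ennreal (z ^ num_particles T B s \<omega> * q ^ num_particles T B t \<omega>) \<partial>M)
      = (\<integral>\<^sup>+\<omega>. weight z s (\<lambda>u. T u \<omega>) * weight q t (\<lambda>u. T u \<omega>) \<partial>M)"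
  proof (rule nn_integral_cong_AE)
    have "AE \<omega> in M. finite (alive clock s (\<lambda>u. T u \<omega>))" "AE \<omega> in M. finite (alive clock t (\<lambda>u. T u \<omega>))"
      using s by (auto intro!: AE_lifetimes AE_alive_finite)
    then show "AE \<omega> in M. ennreal (z ^ num_particles T B s \<omega> * q ^ num_particles T B t \<omega>)
        = weight z s (\<lambda>u. T u \<omega>) * weight q t (\<lambda>u. T u \<omega>)"
      by eventually_elim (use z q in \<open>simp add: weight_def num_particles_clock ennreal_mult\<close>)
  qed
  also have "\<dots> = (\<integral>\<^sup>+x. weight z s x * weight q t x \<partial>distr M clock_law (\<lambda>\<omega> u. T u \<omega>))"
    by (subst nn_integral_distr) auto
  also have "\<dots> = ennreal (yule_pgf s (z * yule_pgf (t - s) q))"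
    using nn_integral_weight_two_times[OF z q s(1), of "t - s"] s by (simp add: distr_lifetimes)
  finally show ?thesis .
qed

lemma v_sigma_eq:
  assumes q: "0 < q" "q \<le> 1" and t: "0 \<le> t"
  shows "v_sigma M T B q t = yule_pgf t q / q"
proof -
  have "v_sigma M T B q t = enn2real (\<integral>\<^sup>+\<omega>. ennreal (q ^ (num_particles T B t \<omega> - 1)) \<partial>M)"
    unfolding v_sigma_def by (subst integral_eq_nn_integral) (use q in auto)
  also have "(\<integral>\<^sup>+\<omega>. ennreal (q ^ (num_particles T B t \<omega> - 1)) \<partial>M)
      = (\<integral>\<^sup>+\<omega>. ennreal (1 / q) * ennreal (1 ^ num_particles T B t \<omega> * q ^ num_particles T B t \<omega>) \<partial>M)"
    by (rule nn_integral_cong_AE[OF eventually_mono[OF AE_num_particles_pos[OF t]]])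
       (use q in \<open>auto simp: power_diff simp flip: ennreal_mult\<close>)
  also have "\<dots> = ennreal (1 / q) * ennreal (yule_pgf t q)"
    using joint_pgf[of 1 q t t] q t by (subst nn_integral_cmult) (auto simp: yule_pgf_def)
  finally show ?thesis
    using q yule_pgf_pos[OF q t] by (simp flip: ennreal_mult)
qed

text \<open>Tilting divides \<open>yule_pgf s (z * yule_pgf (t - s) q)\<close> by its value at \<open>z = 1\<close>. Since
  \<open>yule_pgf s\<close> is a fractional linear map, replacing \<open>z\<close> by a multiple of \<open>z\<close> and normalizing
  again yields the generating function of a geometric law.\<close>
lemma tilted_num_particles_geometric:
  assumes lam: "0 < lam" and eps: "0 < eps" and s: "0 \<le> s" "s \<le> t"
  shows "distr (tilted_law M T B lam eps t) (count_space UNIV) (num_particles T B s)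
    = measure_pmf (geometric1_pmf (1 - yule_pgf (t - s) (repulsion lam eps) * (1 - exp (- s))))"
    (is "?\<mu> = measure_pmf (geometric1_pmf ?p)")
proof (rule nat_measure_eqI_pgf)
  define q where "q = repulsion lam eps"
  define \<phi> where "\<phi> = yule_pgf (t - s) q"
  have q: "0 < q" "q < 1" "q \<le> 1" using repulsion_bounds[OF lam eps] by (auto simp: q_def)
  have t: "0 \<le> t" using s by simp
  have phi: "0 < \<phi>" "\<phi> < 1"
    using yule_pgf_pos[of q "t - s"] yule_pgf_le[of q "t - s"] q s by (auto simp: \<phi>_def)
  have semi: "yule_pgf t q = yule_pgf s \<phi>"
    using yule_pgf_semigroup[of q s "t - s"] q s by (simp add: \<phi>_def)
  have p_eq: "?p = 1 - \<phi> * (1 - exp (- s))" by (simp add: \<phi>_def q_def)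
  have pos: "0 < yule_pgf t q" by (rule yule_pgf_pos) (use q t in auto)
  have p: "0 < ?p" "?p \<le> 1"
  proof -
    have "\<phi> * (1 - exp (- s)) \<le> \<phi>" using phi by (intro mult_left_le) auto
    then show "0 < ?p" using phi unfolding p_eq by linarith
    show "?p \<le> 1" using phi s by (simp add: p_eq)
  qed
  have pgf: "(\<integral>\<^sup>+k. ennreal (z ^ k) \<partial>?\<mu>) = ennreal (yule_pgf s (z * \<phi>) / yule_pgf t q)"
    if z: "0 < z" "z \<le> 1" for z
  proof -
    have "(\<integral>\<^sup>+k. ennreal (z ^ k) \<partial>?\<mu>) = (\<integral>\<^sup>+\<omega>. ennreal (q ^ (num_particles T B t \<omega> - 1) / v_sigma M T B q t)
        * ennreal (z ^ num_particles T B s \<omega>) \<partial>M)"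
      unfolding tilted_law_def q_def by (simp add: nn_integral_distr nn_integral_density)
    also have "\<dots> = (\<integral>\<^sup>+\<omega>. ennreal (1 / yule_pgf t q)
        * ennreal (z ^ num_particles T B s \<omega> * q ^ num_particles T B t \<omega>) \<partial>M)"
      by (rule nn_integral_cong_AE[OF eventually_mono[OF AE_num_particles_pos[OF t]]])
         (use q z t pos in \<open>auto simp: v_sigma_eq power_diff mult_ac simp flip: ennreal_mult\<close>)
    also have "\<dots> = ennreal (1 / yule_pgf t q) * ennreal (yule_pgf s (z * \<phi>))"
      using joint_pgf[OF z _ _ s, of q] q by (simp add: nn_integral_cmult \<phi>_def)
    also have "\<dots> = ennreal (yule_pgf s (z * \<phi>) / yule_pgf t q)"
    proof -
      have "z * \<phi> \<le> 1 * 1" using z phi by (intro mult_mono) auto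
      then have "0 < yule_pgf s (z * \<phi>)" using z phi s by (intro yule_pgf_pos) auto
      then show ?thesis using pos by (simp flip: ennreal_mult)
    qed
    finally show ?thesis .
  qed
  show "sets ?\<mu> = UNIV" by simp
  show "finite_measure ?\<mu>"
  proof (rule finite_measureI)
    have "emeasure ?\<mu> (space ?\<mu>) = (\<integral>\<^sup>+k. ennreal (1 ^ k) \<partial>?\<mu>)" by simp
    then show "emeasure ?\<mu> (space ?\<mu>) \<noteq> \<infinity>" using pgf[of 1] by simp
  qed
  show "sets (measure_pmf (geometric1_pmf ?p)) = UNIV" by simp
  show "finite_measure (measure_pmf (geometric1_pmf ?p))" by (rule measure_pmf.finite_measure_axioms)
  show "(\<integral>\<^sup>+k. ennreal (z ^ k) \<partial>?\<mu>) = (\<integral>\<^sup>+k. ennreal (z ^ k) \<partial>geometric1_pmf ?p)"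
    if z: "0 < z" "z < 1" for z
  proof -
    have "yule_pgf s (z * \<phi>) / yule_pgf t q = ?p * z / (1 - (1 - ?p) * z)"
      unfolding semi p_eq using phi by (simp add: yule_pgf_def mult_ac)
    then show ?thesis
      using pgf[of z] pgf_geometric1_pmf[OF p z] z by simp
  qed
qed

lemma weak_conv_tilted_num_particles:
  assumes lam: "0 < lam" and eps: "0 < eps"
    and s: "eventually (\<lambda>t. 0 \<le> s t \<and> s t \<le> t) at_top"
    and lim: "((\<lambda>t. 1 - yule_pgf (t - s t) (repulsion lam eps) * (1 - exp (- s t))) \<longlongrightarrow> p) at_top"
    and p: "0 < p" "p \<le> 1"
  shows "weak_conv_at_top (\<lambda>t. distr (tilted_law M T B lam eps t) borel (\<lambda>\<omega>. real (num_particles T B (s t) \<omega>)))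
     (distr (measure_pmf (geometric1_pmf p)) borel real)"
proof (rule weak_conv_geometric1[OF lim p])
  let ?q = "repulsion lam eps"
  note q = repulsion_bounds[OF lam eps]
  show "eventually (\<lambda>t. 0 < 1 - yule_pgf (t - s t) ?q * (1 - exp (- s t))
      \<and> 1 - yule_pgf (t - s t) ?q * (1 - exp (- s t)) \<le> 1
      \<and> distr (tilted_law M T B lam eps t) borel (\<lambda>\<omega>. real (num_particles T B (s t) \<omega>))
        = distr (measure_pmf (geometric1_pmf (1 - yule_pgf (t - s t) ?q * (1 - exp (- s t))))) borel real) at_top"
    using s
  proof eventually_elim
    fix t assume t: "0 \<le> s t \<and> s t \<le> t"
    define \<phi> where "\<phi> = yule_pgf (t - s t) ?q"
    have phi: "0 < \<phi>" "\<phi> < 1"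
      using yule_pgf_pos[of ?q "t - s t"] yule_pgf_le[of ?q "t - s t"] q t by (auto simp: \<phi>_def)
    have "\<phi> * (1 - exp (- s t)) \<le> \<phi>"
      using phi by (intro mult_left_le) auto
    then have "\<phi> * (1 - exp (- s t)) < 1"
      using phi by linarith
    moreover have "distr (tilted_law M T B lam eps t) borel (\<lambda>\<omega>. real (num_particles T B (s t) \<omega>))
        = distr (distr (tilted_law M T B lam eps t) (count_space UNIV) (num_particles T B (s t))) borel real"
      by (subst distr_distr) (auto simp: tilted_law_def comp_def)
    ultimately show "0 < 1 - \<phi> * (1 - exp (- s t)) \<and> 1 - \<phi> * (1 - exp (- s t)) \<le> 1
      \<and> distr (tilted_law M T B lam eps t) borel (\<lambda>\<omega>. real (num_particles T B (s t) \<omega>))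
        = distr (measure_pmf (geometric1_pmf (1 - \<phi> * (1 - exp (- s t))))) borel real"
      using phi t tilted_num_particles_geometric[OF lam eps, of "s t" t, folded \<phi>_def] by auto
  qed
qed

end

theorem theorem2p2:
  fixes M :: "'a measure"
    and T :: "bool list \<Rightarrow> 'a \<Rightarrow> real"
    and B :: "bool list \<Rightarrow> real \<Rightarrow> 'a \<Rightarrow> real"
    and lam eps \<sigma> :: real
  assumes "branching_brownian_motion M T B"
    and "lam > 0" and "eps > 0"
    and "\<sigma> = repulsion lam eps"
  shows
    "(\<forall>t\<ge>0. distr (tilted_law M T B lam eps t) (count_space UNIV) (num_particles T B t)
             = measure_pmf (geometric1_pmf (1 - \<sigma> * (1 - exp (- t)))))
     \<and> weak_conv_at_top
         (\<lambda>t. distr (tilted_law M T B lam eps t) borel (\<lambda>\<omega>. real (num_particles T B t \<omega>)))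
         (distr (measure_pmf (geometric1_pmf (1 - \<sigma>))) borel real)
     \<and> (\<forall>\<rho>. \<rho> \<le> - ln (1 - \<sigma>) \<longrightarrow>
          weak_conv_at_top
            (\<lambda>t. distr (tilted_law M T B lam eps t) borel
                   (\<lambda>\<omega>. real (num_particles T B (t + ln (1 - \<sigma>) + \<rho>) \<omega>)))
            (distr (measure_pmf (geometric1_pmf (inverse (1 + \<sigma> * exp \<rho>)))) borel real))"
proof -
  interpret branching_brownian_motion M T B by fact
  note \<sigma>_eq = assms(4)
  have \<sigma>: "0 < \<sigma>" "\<sigma> < 1" using repulsion_bounds assms by auto
  have yule_0: "yule_pgf 0 \<sigma> = \<sigma>" by (simp add: yule_pgf_def)
  have exp_lim: "((\<lambda>t::real. exp (- (t + c))) \<longlongrightarrow> 0) at_top" for c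
    by real_asymp
  have part_i: "distr (tilted_law M T B lam eps t) (count_space UNIV) (num_particles T B t)
      = measure_pmf (geometric1_pmf (1 - \<sigma> * (1 - exp (- t))))" if "0 \<le> t" for t
    using tilted_num_particles_geometric[OF assms(2,3) that order_refl] yule_0 by (simp add: \<sigma>_eq)
  have limit_i: "weak_conv_at_top
      (\<lambda>t. distr (tilted_law M T B lam eps t) borel (\<lambda>\<omega>. real (num_particles T B t \<omega>)))
      (distr (measure_pmf (geometric1_pmf (1 - \<sigma>))) borel real)"
  proof (rule weak_conv_tilted_num_particles[OF assms(2,3)])
    show "eventually (\<lambda>t::real. 0 \<le> t \<and> t \<le> t) at_top"
      using eventually_ge_at_top[of 0] by simp
    have "((\<lambda>t. 1 - \<sigma> * (1 - exp (- (t + 0)))) \<longlongrightarrow> 1 - \<sigma> * (1 - 0)) at_top"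
      by (intro tendsto_intros exp_lim)
    then show "((\<lambda>t. 1 - yule_pgf (t - t) (repulsion lam eps) * (1 - exp (- t))) \<longlongrightarrow> 1 - \<sigma>) at_top"
      using yule_0 by (simp add: \<sigma>_eq)
  qed (use \<sigma> in auto)
  have limit_ii: "weak_conv_at_top
      (\<lambda>t. distr (tilted_law M T B lam eps t) borel
             (\<lambda>\<omega>. real (num_particles T B (t + ln (1 - \<sigma>) + \<rho>) \<omega>)))
      (distr (measure_pmf (geometric1_pmf (inverse (1 + \<sigma> * exp \<rho>)))) borel real)"
    if \<rho>: "\<rho> \<le> - ln (1 - \<sigma>)" for \<rho>
  proof -
    (* The observation time lies a fixed delay d before the horizon t, so the parameter at
       time t depends on t only through exp (- (t - d)), which vanishes in the limit. *)
    define d where "d = - ln (1 - \<sigma>) - \<rho>"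
    have d: "0 \<le> d" using \<rho> by (simp add: d_def)
    have s_eq: "t + ln (1 - \<sigma>) + \<rho> = t - d" for t by (simp add: d_def)
    have exp_d: "exp (- d) = (1 - \<sigma>) * exp \<rho>"
      using \<sigma> by (simp add: d_def exp_add)
    have "1 - \<sigma> * (1 - exp (- d)) = (1 - \<sigma>) * (1 + \<sigma> * exp \<rho>)"
      and "\<sigma> * exp (- d) = (1 - \<sigma>) * (\<sigma> * exp \<rho>)"
      unfolding exp_d by (simp_all add: algebra_simps)
    then have "yule_pgf d \<sigma> = \<sigma> * exp \<rho> / (1 + \<sigma> * exp \<rho>)"
      using \<sigma> by (simp add: yule_pgf_def)
    moreover have "0 < 1 + \<sigma> * exp \<rho>" using \<sigma> by (intro add_pos_pos) auto
    ultimately have limit_param: "1 - yule_pgf d \<sigma> = inverse (1 + \<sigma> * exp \<rho>)"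
      by (simp add: field_simps)
    show ?thesis
      unfolding s_eq
    proof (rule weak_conv_tilted_num_particles[OF assms(2,3)])
      show "eventually (\<lambda>t. 0 \<le> t - d \<and> t - d \<le> t) at_top"
        using eventually_ge_at_top[of d] by eventually_elim (use d in auto)
      have "((\<lambda>t. 1 - yule_pgf d \<sigma> * (1 - exp (- (t + (- d))))) \<longlongrightarrow> 1 - yule_pgf d \<sigma> * (1 - 0)) at_top"
        by (intro tendsto_intros exp_lim)
      then show "((\<lambda>t. 1 - yule_pgf (t - (t - d)) (repulsion lam eps) * (1 - exp (- (t - d))))
          \<longlongrightarrow> inverse (1 + \<sigma> * exp \<rho>)) at_top"
        by (simp add: \<sigma>_eq[symmetric] limit_param)
      show "0 < inverse (1 + \<sigma> * exp \<rho>)" "inverse (1 + \<sigma> * exp \<rho>) \<le> 1"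
        using \<sigma> \<open>0 < 1 + \<sigma> * exp \<rho>\<close> by (auto simp: inverse_le_1_iff)
    qed
  qed
  show ?thesis using part_i limit_i limit_ii by blast
qed

end
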